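(* If a function $f:X\to\mathbb R$ is continuous and piecewise linear over the chamber complex $\mathscr C(D)$, then it has at least one minimizer (over $X$) in $\mathscr V(D)$.
   Context: Let $A\in\mathbb R^{m\times n_x}$, $B\in\mathbb R^{m\times n_y}$, $b\in\mathbb R^m$, and $D=\{(x,y)\in\mathbb R^{n_x}\times\mathbb R^{n_y}:Ax+By\le b\}$, assumed compact and full-dimensional. Let $\pi(x,y)=x$ and $X=\pi(D)$. A face of a polytope $P$ is the set of maximizers over $P$ of a linear function ($P$ itself is a face); $\mathscr F(D)$ is the set of all faces of $D$. For $x\in X$ the chamber of $x$ is $\sigma(x)=\bigcap\{\pi(F):F\in\mathscr F(D),\ x\in\pi(F)\}$; the chamber complex is $\mathscr C(D)=\{\sigma(x):x\in X\}$ (a finite polyhedral complex); and $\mathscr V(D)=\{v\in X:\{v\}\in\mathscr C(D)\}$. A function $f:X\to\mathbb R$ is piecewise linear over $\mathscr C(D)$ if there are pairs $(d_C,a_C)\in\mathbb R^{n_x}\times\mathbb R$, $C\in\mathscr C(D)$, such that $f(x)=\sum_{C\in\mathscr C(D)}(\langle d_C,x\rangle+a_C)\mathbf 1_{\mathrm{ri}(C)}(x)$ for all $x\in X$ (ri = relative interior). *)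

theory Defs
  imports "HOL-Analysis.Analysis"
begin

definition feasible_set ::
    "real ^ 'nx ^ 'm \<Rightarrow> real ^ 'ny ^ 'm \<Rightarrow> real ^ 'm \<Rightarrow> ((real ^ 'nx) \<times> (real ^ 'ny)) set"
  where
    \<comment> \<open>The order on vectors is componentwise.\<close>
    "feasible_set A B b = {(x, y). A *v x + B *v y \<le> b}"

text \<open>
  Faces are sets of maximizers of linear functions. Unlike with \<^const>\<open>exposed_face_of\<close>,
  the empty set is not a face of a nonempty compact set; the zero function gives \<open>P\<close> itself.
\<close>
definition faces :: "'a::real_vector set \<Rightarrow> 'a set set"
  where "faces P = {F. \<exists>c :: 'a \<Rightarrow> real. linear c \<and> F = {z \<in> P. \<forall>w\<in>P. c w \<le> c z}}"

definition chamber :: "('a::real_vector \<times> 'b::real_vector) set \<Rightarrow> 'a \<Rightarrow> 'a set"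
  where "chamber D x = \<Inter> {fst ` F | F. F \<in> faces D \<and> x \<in> fst ` F}"

definition chamber_complex :: "('a::real_vector \<times> 'b::real_vector) set \<Rightarrow> 'a set set"
  where "chamber_complex D = {chamber D x | x. x \<in> fst ` D}"

definition chamber_vertices :: "('a::real_vector \<times> 'b::real_vector) set \<Rightarrow> 'a set"
  where "chamber_vertices D = {v \<in> fst ` D. {v} \<in> chamber_complex D}"

text \<open>
  Only the values of \<open>f\<close> on the projection of \<open>D\<close> matter. The sum is a genuine one when \<open>D\<close> is a
  polytope: it has finitely many faces, so its chamber complex is finite.
\<close>
definition piecewise_linear_over_chambers ::
    "('a::euclidean_space \<times> 'b::euclidean_space) set \<Rightarrow> ('a \<Rightarrow> real) \<Rightarrow> bool"
  where "piecewise_linear_over_chambers D f \<longleftrightarrow>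
    (\<exists>(d :: 'a set \<Rightarrow> 'a) (a :: 'a set \<Rightarrow> real). \<forall>x \<in> fst ` D.
       f x = (\<Sum>C\<in>chamber_complex D. (d C \<bullet> x + a C) * indicator (rel_interior C) x))"

end

theory Submission
  imports Defs
begin

text \<open>
  The argument rests on two facts about the chamber complex of a polytope \<open>D\<close>: every point \<open>x\<close> of
  the projection lies in the relative interior of its chamber (\<open>in_rel_interior_chamber\<close>), and the
  chambers of all points in the relative interior of a chamber coincide with that chamber
  (\<open>chamber_eq_of_rel_interior\<close>). Hence the relative interiors of distinct chambers are disjoint,
  the sum defining a piecewise linear function has at most one nonzero term at each point, and by
  continuity such a function agrees with an affine function on each closed chamber
  (\<open>piecewise_linear_affine_on_chamber\<close>).

  Now let \<open>x\<close> be a minimizer of \<open>f\<close> over the compact projection, and let \<open>v\<close> be an extreme point of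
  the chamber of \<open>x\<close>. Since \<open>f\<close> is affine on this chamber and attains its minimum at a
  relative interior point, it is constant there, so \<open>v\<close> is a minimizer too. The chamber of \<open>v\<close> is
  contained in that of \<open>x\<close>, so \<open>v\<close> is extreme in its own chamber; but \<open>v\<close> also lies in the relative
  interior of its own chamber, which must therefore be \<open>{v}\<close>.
\<close>

section \<open>Faces of polytopes\<close>

lemma rel_interior_prolong:
  fixes S :: "'a::euclidean_space set"
  assumes "convex S" "z \<in> rel_interior S" "x \<in> S"
  obtains w t where "w \<in> S" "0 < t" "t < 1" "z = (1 - t) *\<^sub>R x + t *\<^sub>R w"
proof -
  have "S \<noteq> {}" using assms(3) by auto
  then obtain e where e: "e > 1" "(1 - e) *\<^sub>R x + e *\<^sub>R z \<in> S"
    using convex_rel_interior_iff[OF assms(1)] assms(2,3) by blast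
  have "(1 - 1/e) *\<^sub>R x + (1/e) *\<^sub>R ((1 - e) *\<^sub>R x + e *\<^sub>R z) = ((1 - 1/e) + (1/e) * (1 - e)) *\<^sub>R x + z"
    using e(1) by (simp add: scaleR_add_right scaleR_add_left)
  also have "(1 - 1/e) + (1/e) * (1 - e) = 0"
    using e(1) by (simp add: field_simps)
  finally have "z = (1 - 1/e) *\<^sub>R x + (1/e) *\<^sub>R ((1 - e) *\<^sub>R x + e *\<^sub>R z)" by simp
  moreover have "0 < 1/e" "1/e < 1" using e(1) by auto
  ultimately show thesis using that e(2) by blast
qed

lemma polytope_face_containing_in_rel_interior:
  fixes P :: "'a::euclidean_space set"
  assumes "polytope P" "z \<in> P"
  obtains G where "G face_of P" "z \<in> rel_interior G"
proof -
  let ?K = "{G. G face_of P \<and> z \<in> G}"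
  have "finite ?K"
    using finite_polytope_faces[OF assms(1)] by (rule rev_finite_subset) auto
  moreover have "P \<in> ?K"
    using assms by (simp add: face_of_refl polytope_imp_convex)
  ultimately obtain G where G: "G \<in> ?K" and min: "\<And>H. H \<in> ?K \<Longrightarrow> H \<subseteq> G \<Longrightarrow> H = G"
    using finite_has_minimal[of ?K] by blast
  have poly: "polyhedron G"
    using G assms(1) face_of_polytope_polytope polytope_imp_polyhedron by blast
  have "z \<in> rel_interior G"
  proof (rule ccontr)
    assume "z \<notin> rel_interior G"
    then obtain H where H: "H facet_of G" "z \<in> H"
      using G rel_interior_of_polyhedron[OF poly] by auto
    then have "H face_of P" "H \<subseteq> G" "H \<noteq> G"
      using G face_of_trans facet_of_imp_face_of facet_of_imp_subset facet_of_irrefl by blast+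
    with min H(2) show False by blast
  qed
  with G that show thesis by blast
qed

lemma faces_imp_face_of:
  fixes P :: "'a::euclidean_space set"
  assumes "convex P" "F \<in> faces P"
  shows "F face_of P"
proof -
  obtain c :: "'a \<Rightarrow> real" where c: "linear c" and F: "F = {z \<in> P. \<forall>w\<in>P. c w \<le> c z}"
    using assms(2) unfolding faces_def by blast
  define a where "a = adjoint c 1"
  have ca: "c z = a \<bullet> z" for z
    using adjoint_works[OF c, of z 1] by (simp add: a_def inner_commute)
  show ?thesis
  proof (cases "F = {}")
    case False
    then obtain z where z: "z \<in> F" by blast
    have "F = P \<inter> {x. a \<bullet> x = a \<bullet> z}"
      using z unfolding F ca by (auto intro: antisym)
    moreover have "a \<bullet> x \<le> a \<bullet> z" if "x \<in> P" for x
      using z that unfolding F ca by auto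
    ultimately show ?thesis
      using face_of_Int_supporting_hyperplane_le[OF assms(1)] by metis
  qed simp
qed

lemma face_of_imp_faces:
  fixes P :: "'a::euclidean_space set"
  assumes "polyhedron P" "F face_of P" "F \<noteq> {}"
  shows "F \<in> faces P"
proof -
  obtain a b where le: "P \<subseteq> {x. a \<bullet> x \<le> b}" and F: "F = P \<inter> {x. a \<bullet> x = b}"
    using assms exposed_face_of_polyhedron[OF assms(1)] unfolding exposed_face_of_def by blast
  obtain z where "z \<in> P" "a \<bullet> z = b" using F assms(3) by blast
  then have "F = {z \<in> P. \<forall>w\<in>P. a \<bullet> w \<le> a \<bullet> z}"
    using le unfolding F by (auto intro: antisym)
  moreover have "linear (\<lambda>x. a \<bullet> x)"
    by (simp add: bounded_linear.linear bounded_linear_inner_right)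
  ultimately show ?thesis unfolding faces_def by blast
qed

lemma polytope_faces:
  fixes D :: "'a::euclidean_space set"
  assumes "polytope D" "F \<in> faces D"
  shows "F face_of D" "F \<subseteq> D" "polytope F"
  using faces_imp_face_of[OF polytope_imp_convex] face_of_imp_subset face_of_polytope_polytope assms
  by blast+

lemma self_in_faces: "D \<in> faces D"
  unfolding faces_def
  by (intro CollectI exI[of _ "\<lambda>_. 0"]) (auto simp: linear_iff)

lemma finite_faces:
  fixes D :: "'a::euclidean_space set"
  assumes "polytope D"
  shows "finite (faces D)"
  using finite_polytope_faces[OF assms] polytope_faces(1)[OF assms]
  by (metis (no_types, lifting) finite_subset mem_Collect_eq subsetI)

section \<open>The chamber complex\<close>

lemma finite_chamber_complex:
  fixes D :: "('a::euclidean_space \<times> 'b::euclidean_space) set"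
  assumes "polytope D"
  shows "finite (chamber_complex D)"
proof -
  have "chamber_complex D \<subseteq> Inter ` Pow ((`) fst ` faces D)"
    unfolding chamber_complex_def chamber_def by blast
  then show ?thesis
    by (rule finite_subset) (simp add: finite_faces assms)
qed

lemma mem_chamber_self: "x \<in> chamber D x"
  unfolding chamber_def by blast

lemma chamber_subset_face:
  "F \<in> faces D \<Longrightarrow> x \<in> fst ` F \<Longrightarrow> chamber D x \<subseteq> fst ` F"
  unfolding chamber_def by blast

lemma chamber_subset_projection: "x \<in> fst ` D \<Longrightarrow> chamber D x \<subseteq> fst ` D"
  using chamber_subset_face self_in_faces by blast

lemma chamber_antimono:
  assumes "x' \<in> chamber D x"
  shows "chamber D x' \<subseteq> chamber D x"
  using assms unfolding chamber_def by blast

lemma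
  fixes D :: "('a::euclidean_space \<times> 'b::euclidean_space) set"
  assumes "polytope D"
  shows convex_chamber: "convex (chamber D x)"
    and closed_chamber: "closed (chamber D x)"
proof -
  have "polytope (fst ` F)" if "F \<in> faces D" for F
    using polytope_faces(3)[OF assms that] by (simp add: polytope_linear_image linear_fst)
  then have "convex S \<and> closed S" if "S \<in> {fst ` F | F. F \<in> faces D \<and> x \<in> fst ` F}" for S
    using that polytope_imp_convex polytope_imp_closed by blast
  then show "convex (chamber D x)" "closed (chamber D x)"
    unfolding chamber_def by (meson convex_Inter closed_Inter)+
qed

lemma compact_chamber:
  fixes D :: "('a::euclidean_space \<times> 'b::euclidean_space) set"
  assumes "polytope D" "x \<in> fst ` D"
  shows "compact (chamber D x)"
proof -
  have "compact (fst ` D)"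
    using assms(1) by (simp add: polytope_imp_compact polytope_linear_image linear_fst)
  then show ?thesis
    using closed_chamber[OF assms(1)] chamber_subset_projection[OF assms(2)]
    by (metis compact_Int_closed inf.absorb_iff2)
qed

text \<open>
  A face \<open>F\<close> whose projection contains \<open>x\<close> may have \<open>x\<close> on the relative boundary of this projection,
  but \<open>F\<close> contains a face that has a point over \<open>x\<close> in its relative interior.
  So the chamber is a
  finite intersection of convex sets that all have \<open>x\<close> in their relative interior.
\<close>
lemma in_rel_interior_chamber:
  fixes D :: "('a::euclidean_space \<times> 'b::euclidean_space) set"
  assumes "polytope D"
  shows "x \<in> rel_interior (chamber D x)"
proof -
  let ?K = "{fst ` G | G. G \<in> faces D \<and> x \<in> rel_interior (fst ` G)}"
  have shrink: "\<exists>S\<in>?K. S \<subseteq> fst ` F" if F: "F \<in> faces D" "x \<in> fst ` F" for F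
  proof -
    obtain z where z: "z \<in> F" "x = fst z" using F by blast
    obtain G where G: "G face_of F" "z \<in> rel_interior G"
      using polytope_face_containing_in_rel_interior[OF polytope_faces(3)[OF assms F(1)] z(1)] by blast
    have "G face_of D"
      using G(1) polytope_faces(1)[OF assms F(1)] face_of_trans by blast
    moreover have "G \<noteq> {}" using G(2) by auto
    ultimately have "G \<in> faces D"
      using face_of_imp_faces assms polytope_imp_polyhedron by blast
    moreover have "x \<in> rel_interior (fst ` G)"
      using rel_interior_convex_linear_image[OF linear_fst face_of_imp_convex[OF G(1)]] G(2) z(2)
      by blast
    ultimately show ?thesis using face_of_imp_subset[OF G(1)] by blast
  qed
  have sub: "?K \<subseteq> {fst ` F | F. F \<in> faces D \<and> x \<in> fst ` F}"
    using rel_interior_subset by blast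
  have eq: "chamber D x = \<Inter> ?K"
  proof
    show "chamber D x \<subseteq> \<Inter> ?K"
      unfolding chamber_def using sub by (rule Inter_anti_mono)
    have "\<Inter> ?K \<subseteq> S" if S: "S \<in> {fst ` F | F. F \<in> faces D \<and> x \<in> fst ` F}" for S
    proof -
      obtain F where F: "F \<in> faces D" "x \<in> fst ` F" "S = fst ` F" using S by blast
      obtain T where T: "T \<in> ?K" "T \<subseteq> S"
        using shrink[OF F(1,2)] unfolding F(3) by (rule bexE)
      show ?thesis by (rule subset_trans[OF Inter_lower[OF T(1)] T(2)])
    qed
    then show "\<Inter> ?K \<subseteq> chamber D x"
      unfolding chamber_def by (rule Inter_greatest)
  qed
  have "?K \<subseteq> (`) fst ` faces D" by blast
  then have "finite ?K" using finite_faces[OF assms] finite_surj by blast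
  moreover have "convex S" if "S \<in> ?K" for S
    using that polytope_faces(3)[OF assms] polytope_imp_convex convex_linear_image[OF linear_fst]
    by blast
  moreover have x: "x \<in> \<Inter> (rel_interior ` ?K)" by blast
  moreover from x have "\<Inter> (rel_interior ` ?K) \<noteq> {}" by (metis empty_iff)
  ultimately have "rel_interior (\<Inter> ?K) = \<Inter> (rel_interior ` ?K)"
    by (metis (no_types, lifting) convex_rel_interior_finite_Inter)
  with x show ?thesis unfolding eq by (simp only:)
qed

text \<open>
  The point is that if \<open>F\<close> is a face whose projection contains \<open>x'\<close>, then its projection also contains
  \<open>x\<close>. Let \<open>l\<close> be a linear function maximized over \<open>D\<close> exactly on \<open>F\<close>, let \<open>z\<close> maximize \<open>l\<close> over the
  fibre of \<open>D\<close> above \<open>x\<close>, and let \<open>G\<close> be a face with \<open>z\<close> in its relative interior. Every point of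
  \<open>G\<close> then maximizes \<open>l\<close> over its own fibre. The projection of \<open>G\<close> contains the chamber of \<open>x\<close>, so
  some segment in \<open>G\<close> starts at \<open>z\<close> and has an interior point over \<open>x'\<close>. That interior point attains
  the maximum of \<open>l\<close> over \<open>D\<close>, because the fibre above \<open>x'\<close> meets \<open>F\<close>; hence so does \<open>z\<close>.
\<close>
lemma chamber_eq_of_rel_interior:
  fixes D :: "('a::euclidean_space \<times> 'b::euclidean_space) set"
  assumes poly: "polytope D" and x: "x \<in> fst ` D" and x': "x' \<in> rel_interior (chamber D x)"
  shows "chamber D x' = chamber D x"
proof
  have x'in: "x' \<in> chamber D x" using x' rel_interior_subset by blast
  then show "chamber D x' \<subseteq> chamber D x" by (rule chamber_antimono)
  have convD: "convex D" by (rule polytope_imp_convex[OF poly])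
  have "x \<in> fst ` F" if F: "F \<in> faces D" and x'F: "x' \<in> fst ` F" for F
  proof -
    obtain l :: "'a \<times> 'b \<Rightarrow> real" where l: "linear l" and F_eq: "F = {z \<in> D. \<forall>w\<in>D. l w \<le> l z}"
      using F unfolding faces_def by blast
    obtain p where p: "p \<in> F" "fst p = x'" using x'F by auto
    have pmax: "l w \<le> l p" if "w \<in> D" for w using p(1) that F_eq by blast
    define fib where "fib = D \<inter> {w. fst w = x}"
    have "closed {w :: 'a \<times> 'b. fst w = x}"
      by (intro closed_Collect_eq continuous_intros)
    then have "compact fib"
      using poly by (simp add: fib_def polytope_imp_compact compact_Int_closed)
    moreover have "fib \<noteq> {}" using x by (auto simp: fib_def)
    moreover have "continuous_on fib l" by (simp add: l linear_continuous_on linear_linear)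
    ultimately obtain z where z: "z \<in> fib" and zmax: "\<And>w. w \<in> fib \<Longrightarrow> l w \<le> l z"
      using continuous_attains_sup[of fib l] by blast
    have zD: "z \<in> D" "fst z = x" using z by (auto simp: fib_def)
    obtain G where G: "G face_of D" "z \<in> rel_interior G"
      using polytope_face_containing_in_rel_interior[OF poly zD(1)] by blast
    have convG: "convex G" using G(1) face_of_imp_convex by blast
    have zG: "z \<in> G" using G(2) rel_interior_subset by blast
    have GD: "G \<subseteq> D" using G(1) face_of_imp_subset by blast
    have "G \<in> faces D"
      using face_of_imp_faces[OF polytope_imp_polyhedron[OF poly] G(1)] zG by blast
    then have chG: "chamber D x \<subseteq> fst ` G"
      using chamber_subset_face zG zD(2) by blast
    have Gopt: "l q \<le> l g" if g: "g \<in> G" and q: "q \<in> D" "fst q = fst g" for g q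
    proof -
      obtain w t where w: "w \<in> G" "0 < t" "t < 1" "z = (1 - t) *\<^sub>R g + t *\<^sub>R w"
        using rel_interior_prolong[OF convG G(2) g] by blast
      \<comment> \<open>Replacing \<open>g\<close> by \<open>q\<close> keeps the combination in the fibre of \<open>z\<close>, where \<open>z\<close> is optimal.\<close>
      define z' where "z' = (1 - t) *\<^sub>R q + t *\<^sub>R w"
      have "z' \<in> D"
        unfolding z'_def using w q GD by (intro convexD[OF convD]) auto
      moreover have "fst z' = x"
        using q(2) w(4) zD(2) by (auto simp: z'_def)
      ultimately have "l z' \<le> l z" using zmax by (simp add: fib_def)
      then have "(1 - t) * l q \<le> (1 - t) * l g"
        unfolding z'_def w(4) by (simp add: linear_add[OF l] linear_cmul[OF l])
      with w(3) show ?thesis by simp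
    qed
    obtain x'' t where x'': "x'' \<in> chamber D x" "0 < t" "t < 1" "x' = (1 - t) *\<^sub>R x + t *\<^sub>R x''"
      using rel_interior_prolong[OF convex_chamber[OF poly] x' mem_chamber_self] by blast
    obtain w where w: "w \<in> G" "fst w = x''" using chG x''(1) by auto
    define g where "g = (1 - t) *\<^sub>R z + t *\<^sub>R w"
    have "g \<in> G" unfolding g_def using w zG x'' by (intro convexD[OF convG]) auto
    moreover have "fst p = fst g" by (simp add: g_def p(2) w(2) zD(2) x''(4))
    ultimately have "l p \<le> l g" using Gopt p(1) F_eq by blast
    then have "l p \<le> (1 - t) * l z + t * l w"
      by (simp add: g_def linear_add[OF l] linear_cmul[OF l])
    moreover have "t * l w \<le> t * l p"
      using pmax[of w] w(1) GD x''(2) by (intro mult_left_mono) auto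
    ultimately have "(1 - t) * l p \<le> (1 - t) * l z" by (simp add: algebra_simps)
    then have "l p \<le> l z" using x''(3) by simp
    then have "z \<in> F" using pmax zD(1) unfolding F_eq by force
    then show ?thesis using zD(2) by blast
  qed
  then show "chamber D x \<subseteq> chamber D x'"
    unfolding chamber_def by blast
qed

section \<open>Piecewise linear functions over the chamber complex\<close>

lemma piecewise_linear_affine_on_chamber:
  fixes D :: "('a::euclidean_space \<times> 'b::euclidean_space) set"
  assumes poly: "polytope D" and x: "x \<in> fst ` D"
    and cont: "continuous_on (fst ` D) f"
    and pl: "piecewise_linear_over_chambers D f"
  obtains d a where "\<And>y. y \<in> chamber D x \<Longrightarrow> f y = d \<bullet> y + a"
proof -
  obtain d a where f: "\<And>y. y \<in> fst ` D \<Longrightarrow>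
      f y = (\<Sum>C\<in>chamber_complex D. (d C \<bullet> y + a C) * indicator (rel_interior C) y)"
    using pl unfolding piecewise_linear_over_chambers_def by blast
  let ?C = "chamber D x"
  have CX: "?C \<subseteq> fst ` D" by (rule chamber_subset_projection[OF x])
  have Cin: "?C \<in> chamber_complex D" using x by (auto simp: chamber_complex_def)
  have on_ri: "f y = d ?C \<bullet> y + a ?C" if y: "y \<in> rel_interior ?C" for y
  proof -
    have yX: "y \<in> fst ` D" using y CX rel_interior_subset by blast
    have "(d C \<bullet> y + a C) * indicator (rel_interior C) y = 0"
      if C: "C \<in> chamber_complex D - {?C}" for C
    proof -
      obtain x1 where x1: "x1 \<in> fst ` D" "C = chamber D x1"
        using C by (auto simp: chamber_complex_def)
      have "y \<notin> rel_interior C"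
        using chamber_eq_of_rel_interior[OF poly x1(1), of y]
          chamber_eq_of_rel_interior[OF poly x y] x1(2) C by auto
      then show ?thesis by simp
    qed
    then have "f y = (d ?C \<bullet> y + a ?C) * indicator (rel_interior ?C) y"
      unfolding f[OF yX] sum.remove[OF finite_chamber_complex[OF poly] Cin]
      by (metis (no_types, lifting) add.right_neutral sum.neutral)
    with y show ?thesis by simp
  qed
  have clo: "closure (rel_interior ?C) = ?C"
    using convex_closure_rel_interior[OF convex_chamber[OF poly]] closed_chamber[OF poly]
    by (metis closure_closed)
  have "continuous_on ?C (\<lambda>y. f y - (d ?C \<bullet> y + a ?C))"
    by (intro continuous_intros continuous_on_subset[OF cont CX])
  then have "f y - (d ?C \<bullet> y + a ?C) = 0" if "y \<in> ?C" for y
    using continuous_constant_on_closure[of "rel_interior ?C" "\<lambda>y. f y - (d ?C \<bullet> y + a ?C)" 0 y]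
      on_ri that unfolding clo by simp
  then show thesis using that by (metis eq_iff_diff_eq_0)
qed

lemma extreme_point_of_chamber_is_chamber_vertex:
  fixes D :: "('a::euclidean_space \<times> 'b::euclidean_space) set"
  assumes poly: "polytope D" and x: "x \<in> fst ` D" and v: "v extreme_point_of chamber D x"
  shows "v \<in> chamber_vertices D"
proof -
  have vC: "v \<in> chamber D x" using v by (simp add: extreme_point_of_def)
  then have vX: "v \<in> fst ` D" using chamber_subset_projection[OF x] by blast
  have "v extreme_point_of chamber D v"
    using v chamber_antimono[OF vC] mem_chamber_self[of v D]
    unfolding extreme_point_of_def by blast
  then have "chamber D v = {v}"
    using extreme_point_not_in_REL_INTERIOR in_rel_interior_chamber[OF poly] by blast
  then show ?thesis
    using vX unfolding chamber_vertices_def chamber_complex_def by blast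
qed

theorem minimizer_in_chamber_vertices:
  fixes D :: "('a::euclidean_space \<times> 'b::euclidean_space) set"
  assumes poly: "polytope D" and "D \<noteq> {}"
    and cont: "continuous_on (fst ` D) f"
    and pl: "piecewise_linear_over_chambers D f"
  shows "\<exists>v \<in> chamber_vertices D. \<forall>x \<in> fst ` D. f v \<le> f x"
proof -
  have "compact (fst ` D)"
    using poly by (simp add: polytope_imp_compact polytope_linear_image linear_fst)
  then obtain x where x: "x \<in> fst ` D" and xmin: "\<And>y. y \<in> fst ` D \<Longrightarrow> f x \<le> f y"
    using continuous_attains_inf[OF _ _ cont] assms(2) by blast
  let ?C = "chamber D x"
  obtain d a where aff: "\<And>y. y \<in> ?C \<Longrightarrow> f y = d \<bullet> y + a"
    using piecewise_linear_affine_on_chamber[OF poly x cont pl] by blast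
  obtain v where v: "v extreme_point_of ?C"
    using extreme_point_exists_convex[OF compact_chamber[OF poly x] convex_chamber[OF poly]]
      mem_chamber_self[of x D] by blast
  then have vC: "v \<in> ?C" by (simp add: extreme_point_of_def)
  obtain w t where w: "w \<in> ?C" "0 < t" "t < 1" "x = (1 - t) *\<^sub>R v + t *\<^sub>R w"
    using rel_interior_prolong[OF convex_chamber[OF poly] in_rel_interior_chamber[OF poly] vC]
    by blast
  have "f x = d \<bullet> ((1 - t) *\<^sub>R v + t *\<^sub>R w) + a"
    using aff[OF mem_chamber_self] w(4) by simp
  also have "\<dots> = (1 - t) * f v + t * f w"
    by (simp add: aff[OF vC] aff[OF w(1)] inner_add_right algebra_simps)
  finally have "f x = (1 - t) * f v + t * f w" .
  moreover have "t * f x \<le> t * f w"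
    using xmin[of w] w(1,2) chamber_subset_projection[OF x] by (intro mult_left_mono) auto
  ultimately have "(1 - t) * f v \<le> (1 - t) * f x" by (simp add: algebra_simps)
  then have "f v \<le> f x" using w(3) by simp
  then have "\<forall>y \<in> fst ` D. f v \<le> f y" using xmin order_trans by blast
  then show ?thesis
    using extreme_point_of_chamber_is_chamber_vertex[OF poly x v] by blast
qed

section \<open>Feasible sets of linear systems\<close>

lemma polyhedron_feasible_set: "polyhedron (feasible_set A B b)"
proof -
  define c where "c i = (row i A, row i B)" for i
  have "(A *v x + B *v y) $ i = c i \<bullet> (x, y)" for x y i
    by (simp add: c_def matrix_vector_mul_component row_def vec_lambda_eta)
  then have "feasible_set A B b = \<Inter> (range (\<lambda>i. {z. c i \<bullet> z \<le> b $ i}))"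
    unfolding feasible_set_def less_eq_vec_def by auto
  then show ?thesis
    by (auto intro!: polyhedron_Inter polyhedron_halfspace_le)
qed

theorem corollary3p2:
  fixes A :: "real ^ 'nx ^ 'm" and B :: "real ^ 'ny ^ 'm" and b :: "real ^ 'm"
    and D :: "((real ^ 'nx) \<times> (real ^ 'ny)) set"
    and f :: "real ^ 'nx \<Rightarrow> real"
  assumes "D = feasible_set A B b"
    and "compact D"
    and "aff_dim D = int (CARD('nx) + CARD('ny))"
    and "continuous_on (fst ` D) f"
    and "piecewise_linear_over_chambers D f"
  shows "\<exists>v \<in> chamber_vertices D. \<forall>x \<in> fst ` D. f v \<le> f x"
proof (rule minimizer_in_chamber_vertices)
  show "polytope D"
    using assms(1,2) polyhedron_feasible_set
    by (simp add: polytope_eq_bounded_polyhedron compact_imp_bounded)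
  show "D \<noteq> {}" using assms(3) by auto
qed (use assms in auto)

end
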